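(* The map $\lambda\mapsto\beta(\lambda)$, from $(0,2)$ to $(1,\infty)$, is not (real-)analytic.
   Context: Definition of $\beta(\lambda)$: for each $\lambda\in(0,2)$, $\beta(\lambda)$ is the unique $\beta>1$ for which there is a homeomorphism $\phi_\lambda:[0,\infty)\to[0,1)$ with $\phi_\lambda\circ T_\lambda=S_\beta\circ\phi_\lambda$; equivalently, the unique $\beta>1$ such that $\mathcal{O}_\beta(1)=\omega_\lambda(\infty)$. The objects involved are as follows. Fix a real number $0<\lambda<2$. Let $h(y)=\frac{1}{\lambda-y}$ and $h_0(y)=\frac{y}{\lambda y+1}$. Define $m_0^\lambda=0$ and, as long as $m_i^\lambda<\lambda$, $m_{i+1}^\lambda=h(m_i^\lambda)$ (so $m_1^\lambda=1/\lambda$). This sequence is increasing and finite: there is an integer $i_\lambda\ge 1$ with $0=m_0^\lambda<m_1^\lambda<\cdots<m_{i_\lambda-1}^\lambda<\lambda\le m_{i_\lambda}^\lambda<\infty$. For $0\le i<i_\lambda$ set $h_{i+1}=h\circ h_i$. Let $I_i^\lambda=[m_i^\lambda,m_{i+1}^\lambda)$ for $0\le i<i_\lambda$ and $I_{i_\lambda}^\lambda=[m_{i_\lambda}^\lambda,\infty)$; these intervals partition $[0,\infty)$. For $i<i_\lambda$, $h_i$ is an increasing bijection from $[0,\infty)$ onto $I_i^\lambda$; $h_{i_\lambda}$ is an increasing bijection from $[0,\ell_\lambda)$ onto $I_{i_\lambda}^\lambda$, where $\ell_\lambda=h_{i_\lambda-1}^{-1}(\lambda)$ if $m_{i_\lambda}^\lambda>\lambda$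 and $\ell_\lambda=\infty$ if $m_{i_\lambda}^\lambda=\lambda$. The map $T_\lambda:[0,\infty)\to[0,\infty)$ is defined by $T_\lambda(x)=h_i^{-1}(x)$ for $x\in I_i^\lambda$. Coding: for $x\in[0,\infty)$, $\omega_\lambda(x)=x_0x_1x_2\ldots$, with $x_n\in\{0,\ldots,i_\lambda\}$ the unique index such that $T_\lambda^n(x)\in I_{x_n}^\lambda$. The map $x\mapsto\omega_\lambda(x)$ is non-decreasing for the lexicographic order, and $\omega_\lambda(\infty)$ denotes its limit as $x\to\infty$ (for each $n$, its prefix of length $n+1$ is the common prefix of length $n+1$ of $\omega_\lambda(x)$ for all sufficiently large real $x$). For $\beta>1$, $S_\beta:[0,1)\to[0,1)$, $S_\beta(t)=\beta t\bmod 1$; for $t\in[0,1)$, $\mathcal{O}_\beta(t)=(t_n)_{n\ge0}$ with $t_n=\lfloor\beta S_\beta^n(t)\rfloor$ (ordinary integer part); and $\mathcal{O}_\beta(1)$ is the (lexicographically increasing, termwise) limit of $\mathcal{O}_\beta(t)$ as $t\uparrow1$. *)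

theory Defs
  imports "HOL-Analysis.Analysis"
begin

definition h :: "real \<Rightarrow> real \<Rightarrow> real" where
  "h lam y = 1 / (lam - y)"

text \<open>The recursion for the cut points is only meant to be used as long as the current
  cut point is below \<open>lam\<close>, that is, for indices up to \<open>top_index lam\<close>; the values beyond are
  irrelevant. The same holds for the branches.\<close>

primrec cut_point :: "real \<Rightarrow> nat \<Rightarrow> real" where
  "cut_point lam 0 = 0"
| "cut_point lam (Suc i) = h lam (cut_point lam i)"

definition top_index :: "real \<Rightarrow> nat" where
  "top_index lam = (LEAST i. lam \<le> cut_point lam i)"

primrec branch :: "real \<Rightarrow> nat \<Rightarrow> real \<Rightarrow> real" where
  "branch lam 0 = (\<lambda>y. y / (lam * y + 1))"
| "branch lam (Suc i) = h lam \<circ> branch lam i"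

definition piece :: "real \<Rightarrow> nat \<Rightarrow> real set" where
  "piece lam i =
     (if i < top_index lam then {cut_point lam i..<cut_point lam (Suc i)}
      else {cut_point lam i..})"

text \<open>The domain of the last branch is \<open>{0..<l}\<close>, where \<open>l\<close> is the preimage of \<open>lam\<close> under the
  last but one branch if the last cut point exceeds \<open>lam\<close>, and \<open>l = \<infinity>\<close> otherwise.\<close>

definition branch_dom :: "real \<Rightarrow> nat \<Rightarrow> real set" where
  "branch_dom lam i =
     (if i = top_index lam \<and> lam < cut_point lam i
      then {0..<the_inv_into {0..} (branch lam (i - 1)) lam}
      else {0..})"

definition piece_index :: "real \<Rightarrow> real \<Rightarrow> nat" where
  "piece_index lam x = (THE i. i \<le> top_index lam \<and> x \<in> piece lam i)"

definition T :: "real \<Rightarrow> real \<Rightarrow> real" where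
  "T lam x = (let i = piece_index lam x in the_inv_into (branch_dom lam i) (branch lam i) x)"

definition S :: "real \<Rightarrow> real \<Rightarrow> real" where
  "S \<beta> t = frac (\<beta> * t)"

definition conjugate :: "real \<Rightarrow> real \<Rightarrow> bool" where
  "conjugate lam \<beta> \<longleftrightarrow>
     (\<exists>\<phi> \<psi>. homeomorphism {0..} {0..<1} \<phi> \<psi> \<and> (\<forall>x\<ge>0. \<phi> (T lam x) = S \<beta> (\<phi> x)))"

definition beta :: "real \<Rightarrow> real" where
  "beta lam = (THE \<beta>. \<beta> > 1 \<and> conjugate lam \<beta>)"

text \<open>Intended for open \<open>A\<close>: the local power series has to agree with \<open>f\<close> on a full neighbourhood
  of each point.\<close>

definition real_analytic_on :: "(real \<Rightarrow> real) \<Rightarrow> real set \<Rightarrow> bool" where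
  "real_analytic_on f A \<longleftrightarrow> (\<forall>x\<in>A. \<exists>F. (\<lambda>t. f (x + t)) has_fps_expansion F)"

end

theory Submission imports Defs "HOL-Real_Asymp.Real_Asymp" begin

text \<open>The function \<open>beta\<close> is flat to infinite order at \<open>1\<close> from the left, without being constant there.
For \<open>lam = 1\<close> the last branch of the map is \<open>x \<mapsto> x - 1\<close>, with a parabolic fixed point at \<open>\<infinity>\<close>; it
corresponds to \<open>t \<mapsto> 2 * t - 1\<close>, with a repelling fixed point at \<open>1\<close>. Just below \<open>lam = 1\<close> the orbit
of \<open>\<infinity>\<close> leaves the parabolic point slowly, in a number of steps that is only a power of
\<open>1 / (1 - lam)\<close>, whereas the orbit of \<open>1\<close> under \<open>S \<beta>\<close> with \<open>\<beta>\<close> near \<open>2\<close> leaves at an exponential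
rate. Equal escape times therefore make \<open>2 - \<beta>\<close> exponentially small.

This is made precise along the parameters \<open>cos \<theta>\<close> with \<open>\<theta> = pi / (2 * k)\<close>, \<open>k \<ge> 2\<close>, which increase to \<open>1\<close>.
For \<open>0 < lam < 1\<close> there are only two branches. The inverse of the last one is an elliptic Moebius
map with trace \<open>2 * lam\<close>, that is, a rotation by \<open>\<theta>\<close> in the coordinate \<open>arctan (sin \<theta> * x)\<close>, which
runs through \<open>[0, pi/2)\<close>. Since \<open>k\<close> rotation steps lead from \<open>pi/2\<close> to \<open>0\<close>, the map is a Markov map
for the partition into the intervals \<open>[j * \<theta>, (j + 1) * \<theta>)\<close>, and the itinerary of \<open>\<infinity>\<close> is \<open>k\<close> times
the digit \<open>1\<close>. On the other side this is the expansion of \<open>1\<close> for the root \<open>\<beta> > 1\<close> of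
\<open>1/\<beta> + \<dots> + 1/\<beta>^k = 1\<close>. So \<open>beta (cos \<theta>)\<close> is this root (lemma \<open>beta_cos\<close>), which satisfies
\<open>2 - \<beta> = (1/\<beta>)^k\<close>, whereas \<open>1 - cos \<theta>\<close> is of order \<open>1/k\<^sup>2\<close>. An exponentially small but nonzero
quantity cannot agree with a nonzero power series at points of that size
(lemma \<open>has_fps_expansion_vanish_if_flat\<close>).

As \<open>beta\<close> is given by a definite description, both existence and uniqueness of the conjugate slope
have to be shown at the parameters used. Uniqueness reads off the values of a conjugacy on the
partition points (lemma \<open>conjugate_cos_unique\<close>). For existence, a conjugacy is a fixed point of a
renormalisation operator that contracts by \<open>1/\<beta>\<close>; it is injective because no branch decreases
distances in the angle coordinate and the parabolic one strictly increases them
(lemma \<open>conjugating_function\<close>).\<close>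

section \<open>The map for parameters below one\<close>

lemma top_index_eq_1:
  assumes "0 < lam" "lam < 1"
  shows "top_index lam = 1"
  unfolding top_index_def
proof (rule Least_equality)
  have "lam * lam \<le> 1 * 1" using assms by (intro mult_mono) auto
  then show "lam \<le> cut_point lam 1" using assms by (simp add: h_def field_simps)
next
  fix i assume "lam \<le> cut_point lam i"
  then show "1 \<le> i" using assms by (cases i) auto
qed

lemma the_inv_into_eqI:
  assumes "y \<in> A" "f y = x" "\<And>z. z \<in> A \<Longrightarrow> g (f z) = z"
  shows "the_inv_into A f x = g x"
proof -
  have "inj_on f A" using assms(3) by (rule inj_on_inverseI)
  then have "the_inv_into A f x = y" using assms by (intro the_inv_into_f_eq) auto
  then show ?thesis using assms(3)[OF assms(1)] assms(2) by simp
qed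

lemma T_low:
  assumes "0 < lam" "lam < 1" "0 \<le> x" "x < 1 / lam"
  shows "T lam x = x / (1 - lam * x)"
proof -
  have top: "top_index lam = 1" using assms by (intro top_index_eq_1)
  have "piece_index lam x = 0"
    unfolding piece_index_def
    by (rule the_equality) (use assms in \<open>auto simp: top piece_def h_def le_Suc_eq\<close>)
  then have "T lam x = the_inv_into {0..} (branch lam 0) x"
    by (simp add: T_def branch_dom_def top)
  also have "\<dots> = x / (1 - lam * x)"
  proof (rule the_inv_into_eqI[where y = "x / (1 - lam * x)"])
    have "1 - lam * x > 0" using assms by (simp add: field_simps)
    then show "x / (1 - lam * x) \<in> {0..}" "branch lam 0 (x / (1 - lam * x)) = x"
      using assms by (auto simp: field_simps)
  next
    fix z :: real assume "z \<in> {0..}"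
    then have "lam * z + 1 > 0" using assms by (simp add: add_nonneg_pos)
    then show "branch lam 0 z / (1 - lam * branch lam 0 z) = z"
      by (simp add: divide_simps)
  qed
  finally show ?thesis .
qed

lemma T_high:
  assumes "0 < lam" "lam < 1" "1 / lam \<le> x"
  shows "T lam x = (lam * x - 1) / (lam + (1 - lam\<^sup>2) * x)"
proof -
  have top: "top_index lam = 1" using assms by (intro top_index_eq_1)
  have l2: "0 < 1 - lam\<^sup>2" using assms by (simp add: power_less_one_iff)
  have lx: "1 \<le> lam * x" using assms by (simp add: field_simps)
  have x0: "0 < x" using assms by (meson divide_pos_pos less_le_trans zero_less_one)
  have idx: "piece_index lam x = 1"
    unfolding piece_index_def
    by (rule the_equality) (use assms in \<open>auto simp: top piece_def h_def le_Suc_eq\<close>)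
  have "the_inv_into {0..} (branch lam 0) lam = lam / (1 - lam * lam)"
  proof (rule the_inv_into_eqI[where y = "lam / (1 - lam * lam)" and g = "\<lambda>z. z / (1 - lam * z)"])
    show "lam / (1 - lam * lam) \<in> {0..}" "branch lam 0 (lam / (1 - lam * lam)) = lam"
      using assms l2 by (auto simp: field_simps power2_eq_square)
  next
    fix z :: real assume "z \<in> {0..}"
    then have "lam * z + 1 > 0" using assms by (simp add: add_nonneg_pos)
    then show "branch lam 0 z / (1 - lam * branch lam 0 z) = z"
      by (simp add: divide_simps)
  qed
  moreover have "lam < 1 / lam" using assms l2 by (simp add: field_simps power2_eq_square)
  ultimately have dom: "branch_dom lam 1 = {0..<lam / (1 - lam\<^sup>2)}"
    by (simp add: branch_dom_def top h_def power2_eq_square)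
  have pos: "lam + (1 - lam\<^sup>2) * x > 0" using assms l2 x0 by (simp add: add_pos_pos)
  have "T lam x = the_inv_into {0..<lam / (1 - lam\<^sup>2)} (branch lam 1) x"
    by (simp only: T_def Let_def idx dom)
  also have "\<dots> = (lam * x - 1) / (lam + (1 - lam\<^sup>2) * x)"
  proof (rule the_inv_into_eqI[where y = "(lam * x - 1) / (lam + (1 - lam\<^sup>2) * x)"])
    show "(lam * x - 1) / (lam + (1 - lam\<^sup>2) * x) \<in> {0..<lam / (1 - lam\<^sup>2)}"
      using assms l2 pos lx by (auto simp: field_simps power2_eq_square)
    define y where "y = (lam * x - 1) / (lam + (1 - lam\<^sup>2) * x)"
    have "lam * y + 1 = x / (lam + (1 - lam\<^sup>2) * x)"
      using pos by (simp add: y_def field_simps power2_eq_square)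
    then have "y / (lam * y + 1) = (lam * x - 1) / x"
      using pos x0 by (simp add: y_def)
    moreover have "branch lam 1 y = 1 / (lam - y / (lam * y + 1))" by (simp add: h_def)
    moreover have "lam - (lam * x - 1) / x = 1 / x" using x0 by (simp add: field_simps)
    ultimately show "branch lam 1 y = x" by simp
  next
    fix z :: real assume z: "z \<in> {0..<lam / (1 - lam\<^sup>2)}"
    then have a: "lam * z + 1 > 0" using assms by (simp add: add_nonneg_pos)
    have b: "z < lam * (lam * z + 1)" using z l2 by (simp add: field_simps power2_eq_square)
    define w where "w = lam - z / (lam * z + 1)"
    have w0: "w > 0" using a b by (simp add: w_def field_simps)
    have x: "branch lam 1 z = 1 / w" by (simp add: h_def w_def)
    have w: "(lam * z + 1) * w = lam * (lam * z + 1) - z" using a by (simp add: w_def field_simps)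
    have "lam * (1/w) - 1 = (lam - w) / w" using w0 by (simp add: field_simps)
    moreover have "lam + (1 - lam\<^sup>2) * (1/w) = (lam * w + 1 - lam\<^sup>2) / w"
      using w0 by (simp add: field_simps)
    moreover have "lam - w = z / (lam * z + 1)" by (simp add: w_def)
    moreover have "lam * w + 1 - lam\<^sup>2 = 1 / (lam * z + 1)"
      using a by (simp add: w_def field_simps power2_eq_square)
    ultimately have "(lam * (1/w) - 1) / (lam + (1 - lam\<^sup>2) * (1/w)) = z" using w0 a by simp
    then show "(lam * branch lam 1 z - 1) / (lam + (1 - lam\<^sup>2) * branch lam 1 z) = z"
      unfolding x .
  qed
  finally show ?thesis .
qed

lemma T_nonneg:
  assumes "0 < lam" "lam < 1" "0 \<le> x"
  shows "0 \<le> T lam x"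
proof (cases "x < 1 / lam")
  case True
  then show ?thesis using assms by (simp add: T_low field_simps)
next
  case False
  then have "1 \<le> lam * x" using assms by (simp add: field_simps)
  moreover have "0 < lam + (1 - lam\<^sup>2) * x"
    using assms by (simp add: power_less_one_iff add_pos_nonneg less_imp_le)
  ultimately show ?thesis using False assms by (simp add: T_high)
qed

lemma T_eq_0_iff:
  assumes "0 < lam" "lam < 1" "0 \<le> x"
  shows "T lam x = 0 \<longleftrightarrow> x = 0 \<or> x = 1 / lam"
proof (cases "x < 1 / lam")
  case True
  then show ?thesis using assms by (auto simp: T_low field_simps)
next
  case False
  then have "lam + (1 - lam\<^sup>2) * x > 0"
    using assms by (simp add: power_less_one_iff add_pos_nonneg less_imp_le)
  then show ?thesis using False assms by (auto simp: T_high field_simps)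
qed

section \<open>The angle coordinate\<close>

text \<open>The parabolic branch \<open>x / (1 - cos \<theta> * x)\<close> in the coordinate \<open>a = arctan (sin \<theta> * x)\<close>. There it is
\<open>cot a \<mapsto> cot a - cot \<theta>\<close>; the displacement is written as a separate arctangent
because this form is continuous up to both ends \<open>0\<close> and \<open>\<theta>\<close>, where the cotangents are useless, and
because it turns strict expansion into monotonicity of the fraction.\<close>
definition angle_branch :: "real \<Rightarrow> real \<Rightarrow> real" where
  "angle_branch \<theta> a =
     a + arctan (cos \<theta> * (sin a)\<^sup>2 / (sin \<theta> - cos \<theta> * sin a * cos a))"

lemma angle_denominator_pos:
  assumes "0 < \<theta>" "\<theta> < pi / 2" "0 \<le> a" "a \<le> \<theta>"
  shows "0 < sin \<theta> - cos \<theta> * sin a * cos a"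
proof -
  have "sin a \<le> sin \<theta>" "0 \<le> sin a" "0 < cos \<theta>" "0 < sin \<theta>"
    using assms by (auto intro!: sin_monotone_2pi_le sin_ge_zero cos_gt_zero_pi sin_gt_zero)
  moreover have "cos \<theta> < 1" using cos_monotone_0_pi[of 0 \<theta>] assms by simp
  moreover have "cos \<theta> * sin a * cos a \<le> cos \<theta> * sin a * 1"
    using calculation by (intro mult_left_mono) auto
  ultimately have "cos \<theta> * sin a * cos a \<le> cos \<theta> * sin a" "cos \<theta> * sin a \<le> cos \<theta> * sin \<theta>"
      "cos \<theta> * sin \<theta> < 1 * sin \<theta>"
    by (auto intro!: mult_left_mono)
  then show ?thesis by linarith
qed

text \<open>Clearing denominators, the fraction in the displacement increases from \<open>a\<close> to \<open>b\<close> because the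
difference has the factor \<open>sin (b - a) > 0\<close> and the cofactor
\<open>sin \<theta> * sin (a + b) - cos \<theta> * sin a * sin b\<close>, whose negative term is absorbed by
\<open>sin \<theta> * sin a * cos b\<close>.\<close>
lemma angle_branch_expands:
  assumes "0 < \<theta>" "\<theta> < pi / 2" "0 \<le> a" "a < b" "b \<le> \<theta>"
  shows "b - a < angle_branch \<theta> b - angle_branch \<theta> a"
proof -
  let ?d = "\<lambda>a. sin \<theta> - cos \<theta> * sin a * cos a"
  have d: "0 < ?d a" "0 < ?d b" using assms angle_denominator_pos by auto
  have s: "0 \<le> sin a" "0 < sin b" "sin b \<le> sin \<theta>" "0 < cos a" "0 < sin \<theta>"
    using assms by (auto intro!: sin_monotone_2pi_le sin_ge_zero cos_gt_zero_pi sin_gt_zero)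
  have c: "0 < cos \<theta>" "cos \<theta> \<le> cos b"
    using assms by (auto intro!: cos_monotone_0_pi_le cos_gt_zero_pi)
  have "cos \<theta> * (sin a * sin b) \<le> cos b * (sin a * sin \<theta>)"
    using s c by (intro mult_mono mult_left_mono) auto
  moreover have "0 < sin \<theta> * (cos a * sin b)" using s by simp
  ultimately have *: "0 < sin \<theta> * sin (b + a) - cos \<theta> * sin a * sin b"
    by (simp add: sin_add algebra_simps)
  have "0 < sin (b - a)" using assms by (intro sin_gt_zero) auto
  with * have "0 < sin (b - a) * (sin \<theta> * sin (b + a) - cos \<theta> * sin a * sin b)" by simp
  also have "sin (b - a) * (sin \<theta> * sin (b + a) - cos \<theta> * sin a * sin b)
     = sin \<theta> * (sin (b + a) * sin (b - a)) - cos \<theta> * sin a * sin b * sin (b - a)"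
    by (simp add: algebra_simps)
  also have "sin (b + a) * sin (b - a) = (sin b)\<^sup>2 - (sin a)\<^sup>2"
  proof -
    have "sin (b + a) * sin (b - a) = (sin b * cos a)\<^sup>2 - (cos b * sin a)\<^sup>2"
      by (simp add: sin_add sin_diff algebra_simps power2_eq_square)
    also have "\<dots> = (sin b)\<^sup>2 - (sin a)\<^sup>2"
      by (simp add: power_mult_distrib cos_squared_eq algebra_simps)
    finally show ?thesis .
  qed
  also have "sin \<theta> * ((sin b)\<^sup>2 - (sin a)\<^sup>2) - cos \<theta> * sin a * sin b * sin (b - a)
      = (sin b)\<^sup>2 * ?d a - (sin a)\<^sup>2 * ?d b"
    by (simp add: sin_diff algebra_simps power2_eq_square)
  finally have "(sin a)\<^sup>2 / ?d a < (sin b)\<^sup>2 / ?d b" using d by (simp add: field_simps)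
  then have "cos \<theta> * ((sin a)\<^sup>2 / ?d a) < cos \<theta> * ((sin b)\<^sup>2 / ?d b)"
    using c by (intro mult_strict_left_mono) auto
  then have "arctan (cos \<theta> * (sin a)\<^sup>2 / ?d a) < arctan (cos \<theta> * (sin b)\<^sup>2 / ?d b)"
    by (simp add: arctan_less_iff)
  then show ?thesis by (simp add: angle_branch_def)
qed

lemma angle_branch_0 [simp]: "angle_branch \<theta> 0 = 0"
  by (simp add: angle_branch_def)

lemma angle_branch_end:
  assumes "0 < \<theta>" "\<theta> < pi / 2"
  shows "angle_branch \<theta> \<theta> = pi / 2"
proof -
  have s: "0 < sin \<theta>" using assms by (intro sin_gt_zero) auto
  have "sin \<theta> - cos \<theta> * sin \<theta> * cos \<theta> = sin \<theta> * (1 - (cos \<theta>)\<^sup>2)"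
    by (simp add: algebra_simps power2_eq_square)
  also have "\<dots> = sin \<theta> * (sin \<theta>)\<^sup>2" by (simp add: cos_squared_eq)
  finally have "cos \<theta> * (sin \<theta>)\<^sup>2 / (sin \<theta> - cos \<theta> * sin \<theta> * cos \<theta>) = cot \<theta>"
    using s by (simp add: cot_def)
  also have "\<dots> = tan (pi / 2 - \<theta>)" by (simp add: tan_def cot_def sin_diff cos_diff)
  finally show ?thesis using assms by (simp add: angle_branch_def arctan_tan)
qed

lemma continuous_angle_branch:
  assumes "0 < \<theta>" "\<theta> < pi / 2"
  shows "continuous_on {0..\<theta>} (angle_branch \<theta>)"
proof -
  have "sin \<theta> - cos \<theta> * sin a * cos a \<noteq> 0" if "a \<in> {0..\<theta>}" for a
    using angle_denominator_pos[OF assms] that by force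
  then show ?thesis unfolding angle_branch_def by (intro continuous_intros) auto
qed

text \<open>With \<open>t = tan a\<close> and displacement \<open>arctan w\<close>, the addition theorem for the tangent gives
\<open>(t + w) / (1 - t * w) = t * sin \<theta> / (sin \<theta> - cos \<theta> * t)\<close>, the parabolic branch in the
coordinate \<open>t = sin \<theta> * x\<close>.\<close>
lemma arctan_T_low:
  assumes "0 < \<theta>" "\<theta> < pi / 2" "0 \<le> x" "x < 1 / cos \<theta>"
  shows "arctan (sin \<theta> * T (cos \<theta>) x) = angle_branch \<theta> (arctan (sin \<theta> * x))"
proof -
  have c: "0 < cos \<theta>" "cos \<theta> < 1"
    using assms cos_monotone_0_pi[of 0 \<theta>] by (auto intro: cos_gt_zero_pi)
  have s: "0 < sin \<theta>" using assms by (intro sin_gt_zero) auto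
  define t where "t = sin \<theta> * x"
  define a where "a = arctan t"
  have t0: "0 \<le> t" using s assms by (simp add: t_def)
  have tt: "t < tan \<theta>" using s assms c by (simp add: t_def tan_def field_simps)
  have a: "0 \<le> a" "a < \<theta>"
    using t0 arctan_monotone[OF tt] assms by (auto simp: a_def arctan_tan)
  have ta: "tan a = t" by (simp add: a_def tan_arctan)
  have ca: "0 < cos a" using a assms by (intro cos_gt_zero_pi) auto
  have sa: "sin a = t * cos a" using ta ca by (simp add: tan_def field_simps)
  have ca2: "(1 + t\<^sup>2) * (cos a)\<^sup>2 = 1"
    using sin_cos_squared_add2[of a] by (simp add: sa power2_eq_square algebra_simps)
  define d where "d = sin \<theta> * (1 + t\<^sup>2) - cos \<theta> * t"
  have "sin \<theta> - cos \<theta> * sin a * cos a = (cos a)\<^sup>2 * d"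
  proof -
    have "(cos a)\<^sup>2 * d = sin \<theta> * ((1 + t\<^sup>2) * (cos a)\<^sup>2) - cos \<theta> * t * (cos a)\<^sup>2"
      by (simp add: d_def algebra_simps)
    then show ?thesis unfolding ca2 by (simp add: sa power2_eq_square)
  qed
  moreover have "0 < sin \<theta> - cos \<theta> * sin a * cos a"
    using a assms by (intro angle_denominator_pos) auto
  ultimately have q: "cos \<theta> * (sin a)\<^sup>2 / (sin \<theta> - cos \<theta> * sin a * cos a) = cos \<theta> * t\<^sup>2 / d"
      and d: "0 < d"
    using ca by (simp_all add: sa power_mult_distrib zero_less_mult_iff)
  define w where "w = cos \<theta> * t\<^sup>2 / d"
  have ct: "0 < sin \<theta> - cos \<theta> * t" using tt c by (simp add: tan_def field_simps)
  have den: "1 - t * w = (1 + t\<^sup>2) * (sin \<theta> - cos \<theta> * t) / d"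
    using d by (simp add: w_def field_simps) (simp add: d_def algebra_simps power2_eq_square power3_eq_cube)
  have num: "t + w = t * sin \<theta> * (1 + t\<^sup>2) / d"
    using d by (simp add: w_def field_simps) (simp add: d_def algebra_simps power2_eq_square power3_eq_cube)
  have t2: "1 + t\<^sup>2 > 0" by (simp add: add_pos_nonneg)
  have ab: "angle_branch \<theta> a = a + arctan w" by (simp add: angle_branch_def q w_def)
  have "angle_branch \<theta> a < pi / 2"
    using angle_branch_expands[of \<theta> a \<theta>] angle_branch_end a assms by auto
  moreover have "0 \<le> w" using c d by (simp add: w_def)
  moreover have "0 \<le> arctan w" using \<open>0 \<le> w\<close> by simp
  ultimately have rng: "- (pi / 2) < a + arctan w" "a + arctan w < pi / 2"
    using ab a pi_gt_zero by linarith+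
  have "tan (a + arctan w) = (tan a + w) / (1 - tan a * w)"
    using ca cos_gt_zero_pi[OF rng] by (subst tan_add) (auto simp: tan_arctan)
  also have "\<dots> = t * sin \<theta> / (sin \<theta> - cos \<theta> * t)"
    unfolding ta num den using t2 d by simp
  also have "\<dots> = sin \<theta> * (x / (1 - cos \<theta> * x))"
    using s by (simp add: t_def divide_simps) (simp add: algebra_simps)
  also have "\<dots> = sin \<theta> * T (cos \<theta>) x" using T_low[OF c assms(3,4)] by simp
  finally show ?thesis using arctan_tan[OF rng] ab by (simp add: a_def t_def)
qed

text \<open>The elliptic branch is a rotation: multiplied by \<open>sin \<theta>\<close>, it is the subtraction theorem for the
tangent.\<close>
lemma arctan_T_high:
  assumes "0 < \<theta>" "\<theta> < pi / 2" "1 / cos \<theta> \<le> x"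
  shows "arctan (sin \<theta> * T (cos \<theta>) x) = arctan (sin \<theta> * x) - \<theta>"
proof -
  have c: "0 < cos \<theta>" "cos \<theta> < 1"
    using assms cos_monotone_0_pi[of 0 \<theta>] by (auto intro: cos_gt_zero_pi)
  have s: "0 < sin \<theta>" using assms by (intro sin_gt_zero) auto
  define a where "a = arctan (sin \<theta> * x)"
  have "tan \<theta> \<le> sin \<theta> * x" using s assms c by (simp add: tan_def field_simps)
  then have a: "\<theta> \<le> a" using arctan_monotone'[of "tan \<theta>" "sin \<theta> * x"] assms
    by (simp add: a_def arctan_tan)
  have a2: "a < pi / 2" unfolding a_def by (rule arctan_ubound)
  have ca: "0 < cos a" using a a2 assms by (intro cos_gt_zero_pi) auto
  have cd: "0 < cos (a - \<theta>)" using a a2 assms by (intro cos_gt_zero_pi) auto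
  have ta: "tan a = sin \<theta> * x" by (simp add: a_def tan_arctan)
  have "tan (a - \<theta>) = (tan a - tan \<theta>) / (1 + tan a * tan \<theta>)"
    using ca cd c by (intro tan_diff) auto
  also have "\<dots> = (sin \<theta> * x - tan \<theta>) / (1 + sin \<theta> * x * tan \<theta>)" by (simp only: ta)
  also have "sin \<theta> * x - tan \<theta> = sin \<theta> * (cos \<theta> * x - 1) / cos \<theta>"
    using c by (simp add: tan_def field_simps)
  also have "1 + sin \<theta> * x * tan \<theta> = (cos \<theta> + (1 - (cos \<theta>)\<^sup>2) * x) / cos \<theta>"
    using c by (simp add: tan_def field_simps sin_squared_eq[symmetric]) (simp add: power2_eq_square)
  also have "sin \<theta> * (cos \<theta> * x - 1) / cos \<theta> / \<dots> = sin \<theta> * T (cos \<theta>) x"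
    using c by (simp add: T_high[OF c assms(3)])
  finally show ?thesis using a a2 assms arctan_tan[of "a - \<theta>"] by (simp add: a_def)
qed


section \<open>The slopes with a finite expansion of one\<close>

text \<open>The value in base \<open>\<beta>\<close> of the expansion that consists of \<open>j\<close> digits \<open>1\<close>.\<close>
definition geometric_sum :: "real \<Rightarrow> nat \<Rightarrow> real" where
  "geometric_sum \<beta> j = (\<Sum>i<j. (1 / \<beta>) ^ Suc i)"

lemma geometric_sum_0 [simp]: "geometric_sum \<beta> 0 = 0"
  by (simp add: geometric_sum_def)

lemma geometric_sum_Suc: "geometric_sum \<beta> (Suc j) = (1 + geometric_sum \<beta> j) / \<beta>"
  unfolding geometric_sum_def sum.lessThan_Suc_shift
  by (simp add: sum_divide_distrib add_divide_distrib)

lemma geometric_sum_closed_form: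
  assumes "1 < \<beta>"
  shows "geometric_sum \<beta> j = (1 - (1 / \<beta>) ^ j) / (\<beta> - 1)"
proof (induction j)
  case (Suc j)
  show ?case using assms unfolding geometric_sum_Suc Suc by (simp add: divide_simps) (simp add: algebra_simps)
qed simp

lemma geometric_sum_strict_antimono:
  assumes "0 < b" "b < c" "0 < j"
  shows "geometric_sum c j < geometric_sum b j"
  unfolding geometric_sum_def
proof (rule sum_strict_mono)
  have "1 / c < 1 / b" using assms by (intro divide_strict_left_mono) auto
  then show "(1 / c) ^ Suc i < (1 / b) ^ Suc i" for i
    using assms by (intro power_strict_mono) auto
qed (use assms in auto)

lemma geometric_sum_root_exists:
  assumes "2 \<le> k"
  obtains \<beta> where "1 < \<beta>" "geometric_sum \<beta> k = 1"
proof -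
  have "\<exists>b\<ge>1. b \<le> 2 \<and> geometric_sum b k = 1"
  proof (rule IVT2')
    show "geometric_sum 2 k \<le> 1" by (subst geometric_sum_closed_form) auto
    show "1 \<le> geometric_sum 1 k" using assms by (simp add: geometric_sum_def)
    show "continuous_on {1..2} (\<lambda>b. geometric_sum b k)"
      unfolding geometric_sum_def by (intro continuous_intros) auto
  qed simp
  then obtain b where b: "1 \<le> b" "geometric_sum b k = 1" by blast
  moreover have "b \<noteq> 1" using b assms by (auto simp: geometric_sum_def)
  ultimately show ?thesis using that[of b] by simp
qed

lemma geometric_sum_root_bounds:
  assumes "1 < \<beta>" "geometric_sum \<beta> k = 1" "2 \<le> k"
  shows "3 / 2 \<le> \<beta>" "2 - \<beta> = (1 / \<beta>) ^ k"
proof -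
  show "2 - \<beta> = (1 / \<beta>) ^ k"
    using assms geometric_sum_closed_form[of \<beta> k] by (simp add: field_simps)
  have "(\<Sum>i<2. (1 / \<beta>) ^ Suc i) \<le> (\<Sum>i<k. (1 / \<beta>) ^ Suc i)"
    using assms by (intro sum_mono2) auto
  then have "1 / \<beta> + (1 / \<beta>)\<^sup>2 \<le> 1"
    using assms by (simp add: geometric_sum_def numeral_2_eq_2)
  then have *: "\<beta> + 1 \<le> \<beta> * \<beta>"
    using assms by (simp add: field_simps power2_eq_square)
  show "3 / 2 \<le> \<beta>"
  proof (rule ccontr)
    assume "\<not> 3 / 2 \<le> \<beta>"
    then have "\<beta> * \<beta> \<le> 3 / 2 * \<beta>" using assms by (intro mult_right_mono) auto
    with * \<open>\<not> 3 / 2 \<le> \<beta>\<close> show False by simp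
  qed
qed

section \<open>Conjugating an expanding Markov map to a beta transformation\<close>

text \<open>A map of \<open>[0, k * \<theta>]\<close> that shifts by \<open>\<theta>\<close> on \<open>[\<theta>, k * \<theta>]\<close> and stretches \<open>[0, \<theta>]\<close> by \<open>\<rho>\<close> over the
whole interval. Expansion is required only as a strict inequality between distances, with no
uniform factor: this is what allows the fixed point \<open>0\<close> of \<open>\<rho>\<close> to be parabolic.\<close>
locale expanding_markov_map =
  fixes \<theta> \<beta> :: real and k :: nat and \<rho> :: "real \<Rightarrow> real"
  assumes \<theta>: "0 < \<theta>" and k: "0 < k" and \<beta>: "1 < \<beta>"
    and root: "geometric_sum \<beta> k = 1"
    and cont: "continuous_on {0..\<theta>} \<rho>"
    and zero: "\<rho> 0 = 0" and full: "\<rho> \<theta> = k * \<theta>"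
    and expand: "\<And>a b. 0 \<le> a \<Longrightarrow> a < b \<Longrightarrow> b \<le> \<theta> \<Longrightarrow> b - a < \<rho> b - \<rho> a"
begin

abbreviation L :: real where "L \<equiv> k * \<theta>"

lemma step_le: "\<theta> \<le> L" using \<theta> k by simp

lemma rho_mono: "0 \<le> a \<Longrightarrow> a \<le> b \<Longrightarrow> b \<le> \<theta> \<Longrightarrow> \<rho> a \<le> \<rho> b"
  using expand[of a b] by (cases "a = b") auto

lemma rho_range: "0 \<le> a \<Longrightarrow> a \<le> \<theta> \<Longrightarrow> \<rho> a \<in> {0..L}"
  using rho_mono[of 0 a] rho_mono[of a \<theta>] zero full by auto

text \<open>The conjugation equations say that the conjugacy is \<open>f \<circ> \<rho> / \<beta>\<close> on the first piece and
\<open>(1 + f (u - \<theta>)) / \<beta>\<close> on the others. Clamping the arguments expresses both at once, for functions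
with \<open>f 0 = 0\<close> and \<open>f L = 1\<close>, and makes continuity at \<open>\<theta>\<close> automatic.\<close>
definition renorm :: "(real \<Rightarrow> real) \<Rightarrow> real \<Rightarrow> real" where
  "renorm f u = (f (\<rho> (min u \<theta>)) + f (max 0 (u - \<theta>))) / \<beta>"

text \<open>The values at all partition points are prescribed, not only those at the two ends, since
\<open>renorm f L = 1\<close> needs the value of \<open>f\<close> at \<open>L - \<theta>\<close>, which in turn needs that at \<open>L - 2 * \<theta>\<close>, and
so on.\<close>
definition admissible :: "(real \<Rightarrow> real) \<Rightarrow> bool" where
  "admissible f \<longleftrightarrow> continuous_on {0..L} f \<and> mono_on {0..L} f
     \<and> (\<forall>j\<le>k. f (j * \<theta>) = geometric_sum \<beta> j)"

lemma admissible_0: "admissible f \<Longrightarrow> f 0 = 0"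
  unfolding admissible_def by (metis geometric_sum_0 le0 mult_zero_left of_nat_0)

lemma admissible_L: "admissible f \<Longrightarrow> f L = 1"
  unfolding admissible_def using root by simp

lemma renorm_low: "admissible f \<Longrightarrow> u \<le> \<theta> \<Longrightarrow> renorm f u = f (\<rho> u) / \<beta>"
  by (simp add: renorm_def admissible_0)

lemma renorm_high: "admissible f \<Longrightarrow> \<theta> \<le> u \<Longrightarrow> renorm f u = (1 + f (u - \<theta>)) / \<beta>"
  by (simp add: renorm_def admissible_L full)

lemma admissible_renorm:
  assumes f: "admissible f"
  shows "admissible (renorm f)"
proof -
  have cf: "continuous_on {0..L} f" and mf: "mono_on {0..L} f"
    and jf: "\<And>j. j \<le> k \<Longrightarrow> f (j * \<theta>) = geometric_sum \<beta> j"
    using f by (auto simp: admissible_def)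
  have r: "\<rho> (min u \<theta>) \<in> {0..L}" if "u \<in> {0..L}" for u
    using rho_range[of "min u \<theta>"] that \<theta> by auto
  have s: "max 0 (u - \<theta>) \<in> {0..L}" if "u \<in> {0..L}" for u
    using that \<theta> by auto
  have "continuous_on {0..L} (\<lambda>u. \<rho> (min u \<theta>))"
    using \<theta> by (intro continuous_on_compose2[OF cont] continuous_intros) auto
  then have "continuous_on {0..L} (renorm f)"
    unfolding renorm_def using r s \<beta>
    by (intro continuous_intros continuous_on_compose2[OF cf]) auto
  moreover have "mono_on {0..L} (renorm f)"
  proof (rule mono_onI)
    fix u v assume uv: "u \<in> {0..L}" "v \<in> {0..L}" "u \<le> v"
    have "\<rho> (min u \<theta>) \<le> \<rho> (min v \<theta>)" using uv \<theta> by (intro rho_mono) auto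
    then have "f (\<rho> (min u \<theta>)) \<le> f (\<rho> (min v \<theta>))"
      using mono_onD[OF mf] r uv by blast
    moreover have "f (max 0 (u - \<theta>)) \<le> f (max 0 (v - \<theta>))"
      using uv s by (intro mono_onD[OF mf]) auto
    ultimately show "renorm f u \<le> renorm f v"
      using \<beta> by (simp add: renorm_def divide_right_mono)
  qed
  moreover have "renorm f (j * \<theta>) = geometric_sum \<beta> j" if "j \<le> k" for j
  proof (cases j)
    case 0
    then show ?thesis using renorm_low[OF f, of 0] \<theta> zero admissible_0[OF f] by simp
  next
    case (Suc i)
    have "real j * \<theta> - \<theta> = real i * \<theta>" by (simp add: Suc algebra_simps)
    moreover have "\<theta> \<le> real j * \<theta>" using \<theta> Suc by simp
    ultimately show ?thesis using renorm_high[OF f, of "j * \<theta>"] jf[of i] Suc that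
      by (simp add: geometric_sum_Suc)
  qed
  ultimately show ?thesis by (simp add: admissible_def)
qed

text \<open>The closed form of the partial geometric sums, interpolated to real indices \<open>u / \<theta>\<close>: an explicit
increasing function with the prescribed values.\<close>
definition seed :: "real \<Rightarrow> real" where
  "seed u = (1 - \<beta> powr (- u / \<theta>)) / (\<beta> - 1)"

lemma admissible_seed: "admissible seed"
  unfolding admissible_def
proof (intro conjI allI impI)
  show "continuous_on {0..L} seed"
    unfolding seed_def using \<beta> \<theta> by (intro continuous_intros) auto
  show "mono_on {0..L} seed"
    unfolding seed_def using \<beta> \<theta>
    by (intro mono_onI divide_right_mono diff_left_mono powr_mono) (auto simp: divide_right_mono)
  fix j assume "j \<le> k"
  have "\<beta> powr (- (real j * \<theta>) / \<theta>) = (1 / \<beta>) ^ j"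
    using \<theta> \<beta> by (simp add: powr_minus powr_realpow power_divide divide_simps)
  then show "seed (j * \<theta>) = geometric_sum \<beta> j"
    using \<beta> by (simp add: seed_def geometric_sum_closed_form)
qed

definition approx :: "nat \<Rightarrow> real \<Rightarrow> real" where
  "approx n = (renorm ^^ n) seed"

lemma approx_Suc: "approx (Suc n) = renorm (approx n)"
  by (simp add: approx_def)

lemma admissible_approx: "admissible (approx n)"
  by (induction n) (simp_all add: approx_def admissible_seed admissible_renorm)

lemma admissible_range:
  assumes "admissible f" "u \<in> {0..L}"
  shows "0 \<le> f u" "f u \<le> 1"
proof -
  have "mono_on {0..L} f" using assms by (simp add: admissible_def)
  then have "f 0 \<le> f u" "f u \<le> f L"
    using assms(2) by (auto intro: mono_onD)
  then show "0 \<le> f u" "f u \<le> 1"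
    using assms(1) by (simp_all add: admissible_0 admissible_L)
qed

text \<open>The operator contracts by \<open>1/\<beta>\<close>: at each point, the difference of two images is \<open>1/\<beta>\<close> times the
difference of the two functions at a single other point, the term from the other branch being the
same for both.\<close>
lemma approx_diff:
  "u \<in> {0..L} \<Longrightarrow> \<bar>approx (Suc n) u - approx n u\<bar> \<le> (1 / \<beta>) ^ n"
proof (induction n arbitrary: u)
  case 0
  show ?case
    using admissible_range[OF admissible_approx[of 0] 0] admissible_range[OF admissible_approx[of 1] 0]
    by simp
next
  case (Suc n)
  let ?f = "approx (Suc n)" and ?g = "approx n"
  note ad = admissible_approx[of "Suc n"] admissible_approx[of n]
  obtain v where v: "v \<in> {0..L}" "renorm ?f u - renorm ?g u = (?f v - ?g v) / \<beta>"
  proof (cases "u \<le> \<theta>")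
    case True
    with Suc.prems ad show ?thesis
      by (intro that[of "\<rho> u"]) (use rho_range[of u] in \<open>auto simp: renorm_low diff_divide_distrib\<close>)
  next
    case False
    with Suc.prems ad \<theta> show ?thesis
      by (intro that[of "u - \<theta>"]) (auto simp: renorm_high simp flip: diff_divide_distrib)
  qed
  have "\<bar>approx (Suc (Suc n)) u - approx (Suc n) u\<bar> = \<bar>?f v - ?g v\<bar> / \<beta>"
    using v \<beta> by (simp add: approx_Suc[of "Suc n"] approx_Suc[of n, symmetric])
  also have "\<dots> \<le> (1 / \<beta>) ^ n / \<beta>"
    using Suc.IH[OF v(1)] \<beta> by (intro divide_right_mono) auto
  finally show ?case by simp
qed

lemma admissible_fixed_point: "\<exists>\<phi>. admissible \<phi> \<and> (\<forall>u\<in>{0..L}. \<phi> u = renorm \<phi> u)"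
proof -
  have "uniformly_convergent_on {0..L} (\<lambda>n u. \<Sum>i<n. approx (Suc i) u - approx i u)"
    using approx_diff \<beta> by (intro Weierstrass_m_test'[where M = "\<lambda>n. (1 / \<beta>) ^ n"]) auto
  then obtain g where "uniform_limit {0..L} (\<lambda>n u. \<Sum>i<n. approx (Suc i) u - approx i u) g sequentially"
    unfolding uniformly_convergent_on_def by blast
  moreover have "(\<Sum>i<n. approx (Suc i) u - approx i u) = approx n u - approx 0 u" for n u
    by (rule sum_lessThan_telescope[of "\<lambda>i. approx i u"])
  ultimately have "uniform_limit {0..L} (\<lambda>n u. approx n u - approx 0 u) g sequentially" by simp
  then have "uniform_limit {0..L} (\<lambda>n u. approx 0 u + (approx n u - approx 0 u))
      (\<lambda>u. approx 0 u + g u) sequentially"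
    by (intro uniform_limit_intros)
  then obtain \<phi> where lim: "uniform_limit {0..L} approx \<phi> sequentially" by auto
  then have pt: "(\<lambda>n. approx n u) \<longlonglongrightarrow> \<phi> u" if "u \<in> {0..L}" for u
    using that by (rule tendsto_uniform_limitI)
  have "continuous_on {0..L} \<phi>"
    by (rule uniform_limit_theorem[OF _ lim]) (use admissible_approx in \<open>auto simp: admissible_def\<close>)
  moreover have "mono_on {0..L} \<phi>"
  proof (rule mono_onI)
    fix u v assume uv: "u \<in> {0..L}" "v \<in> {0..L}" "u \<le> v"
    then have "approx n u \<le> approx n v" for n
      using admissible_approx[of n] by (auto simp: admissible_def intro: mono_onD)
    then show "\<phi> u \<le> \<phi> v" using pt[OF uv(1)] pt[OF uv(2)] by (intro LIMSEQ_le) auto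
  qed
  moreover have "\<phi> (j * \<theta>) = geometric_sum \<beta> j" if "j \<le> k" for j
  proof (rule LIMSEQ_unique[OF pt])
    show "j * \<theta> \<in> {0..L}" using that \<theta> by auto
    show "(\<lambda>n. approx n (j * \<theta>)) \<longlonglongrightarrow> geometric_sum \<beta> j"
      using admissible_approx that by (simp add: admissible_def)
  qed
  ultimately have "admissible \<phi>" by (simp add: admissible_def)
  moreover have "\<phi> u = renorm \<phi> u" if u: "u \<in> {0..L}" for u
  proof (rule LIMSEQ_unique[OF LIMSEQ_Suc[OF pt[OF u]]])
    show "(\<lambda>n. approx (Suc n) u) \<longlonglongrightarrow> renorm \<phi> u"
      unfolding approx_Suc renorm_def
      using u \<theta> \<beta> rho_range[of "min u \<theta>"] by (intro tendsto_intros pt) auto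
  qed
  ultimately show ?thesis by blast
qed

text \<open>The fixed point is continuous and monotone, so only plateaus have to be excluded. Pairs of points
with the same value form a compact set, hence some pair has maximal distance. If it were positive,
shifting the pair by \<open>\<theta>\<close> as often as possible keeps the distance and the equality of values,
until the left point is below \<open>\<theta>\<close>; the pair cannot straddle \<open>\<theta>\<close>, as the values beyond \<open>\<theta>\<close> exceed
\<open>1/\<beta>\<close> and those before do not; so it lies in \<open>[0, \<theta>]\<close>, and \<open>\<rho>\<close> makes it into a pair at larger distance.\<close>
lemma conjugating_function:
  obtains \<phi> where "continuous_on {0..L} \<phi>" "strict_mono_on {0..L} \<phi>" "\<phi> 0 = 0" "\<phi> L = 1"
    "\<And>u. u \<in> {0..\<theta>} \<Longrightarrow> \<phi> (\<rho> u) = \<beta> * \<phi> u"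
    "\<And>u. u \<in> {\<theta>..L} \<Longrightarrow> \<phi> (u - \<theta>) = \<beta> * \<phi> u - 1"
proof -
  obtain \<phi> where ad: "admissible \<phi>" and fix1: "\<And>u. u \<in> {0..L} \<Longrightarrow> \<phi> u = renorm \<phi> u"
    using admissible_fixed_point by blast
  have co: "continuous_on {0..L} \<phi>" and mo: "mono_on {0..L} \<phi>"
    using ad by (auto simp: admissible_def)
  have low: "\<phi> (\<rho> u) = \<beta> * \<phi> u" if "u \<in> {0..\<theta>}" for u
    using fix1[of u] renorm_low[OF ad, of u] that step_le \<beta> by simp
  have high: "\<phi> (u - \<theta>) = \<beta> * \<phi> u - 1" if "u \<in> {\<theta>..L}" for u
    using fix1[of u] renorm_high[OF ad, of u] that \<theta> \<beta> by simp
  have at_step: "\<beta> * \<phi> \<theta> = 1"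
    using low[of \<theta>] \<theta> by (simp add: full admissible_L[OF ad])
  \<comment> \<open>The largest zero lies below \<open>\<theta>\<close> and cannot be positive, because \<open>\<rho>\<close> would map it to a larger zero.\<close>
  have pos: "0 < \<phi> z" if z: "z \<in> {0<..L}" for z
  proof (rule ccontr)
    assume "\<not> 0 < \<phi> z"
    with z have \<phi>z: "\<phi> z = 0" using admissible_range[OF ad, of z] by simp
    let ?Z = "{0..L} \<inter> \<phi> -` {0}"
    have "compact ?Z"
      by (intro compact_Int_closed[of "{0..L}" ?Z, simplified Int_assoc[symmetric] Int_absorb]
           continuous_closed_preimage co) auto
    moreover have "z \<in> ?Z" using z \<phi>z by simp
    ultimately obtain w where w: "w \<in> ?Z" "\<And>v. v \<in> ?Z \<Longrightarrow> v \<le> w"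
      using compact_attains_sup[of ?Z] by blast
    have w0: "0 < w" using w(2)[of z] z \<phi>z by simp
    have "w < \<theta>"
    proof (rule ccontr)
      assume "\<not> w < \<theta>"
      then have "\<phi> \<theta> \<le> \<phi> w" using w(1) \<theta> step_le by (intro mono_onD[OF mo]) auto
      then have "\<beta> * \<phi> \<theta> \<le> \<beta> * \<phi> w" using \<beta> by simp
      then show False using w(1) at_step by simp
    qed
    then have "\<rho> w \<in> ?Z" using w(1) low[of w] rho_range[of w] by simp
    then show False using w(2)[of "\<rho> w"] expand[of 0 w] w0 \<open>w < \<theta>\<close> zero by simp
  qed
  \<comment> \<open>A pair \<open>(x, y)\<close> of maximal distance among those with equal values.\<close>
  let ?K = "({0..L} \<times> {0..L}) \<inter> (\<lambda>p. \<phi> (fst p) - \<phi> (snd p)) -` {0}"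
  have "continuous_on ({0..L} \<times> {0..L}) (\<lambda>p. \<phi> (fst p) - \<phi> (snd p))"
    by (intro continuous_intros continuous_on_compose2[OF co]) auto
  then have "closed ?K"
    by (intro continuous_closed_preimage) (auto intro: closed_Times)
  then have "compact (({0..L} \<times> {0..L}) \<inter> ?K)"
    by (intro compact_Int_closed compact_Times) auto
  then have K: "compact ?K" by (simp add: Int_assoc[symmetric])
  have "(0, 0) \<in> ?K" using \<theta> by simp
  then have "\<exists>p\<in>?K. \<forall>q\<in>?K. snd q - fst q \<le> snd p - fst p"
    by (intro continuous_attains_sup[OF K] continuous_intros) blast
  then obtain p where p: "p \<in> ?K" "\<forall>q\<in>?K. snd q - fst q \<le> snd p - fst p" ..
  define x y where "x = fst p" and "y = snd p"
  have xy: "(x, y) \<in> ?K" using p(1) by (simp add: x_def y_def)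
  have max: "y' - x' \<le> y - x" if "(x', y') \<in> ?K" for x' y'
    using bspec[OF p(2) that] by (simp add: x_def y_def)
  \<comment> \<open>Induction on the number of shifts that bring the left end of a longest plateau below \<open>\<theta>\<close>.\<close>
  have no_plateau: "\<not> (0 \<le> x' \<and> y' \<le> L \<and> \<phi> x' = \<phi> y' \<and> y' - x' = y - x \<and> x' < n * \<theta>)"
    if "x < y" for x' y' and n :: nat
  proof (induction n arbitrary: x' y')
    case (Suc n)
    show ?case
    proof
      assume a: "0 \<le> x' \<and> y' \<le> L \<and> \<phi> x' = \<phi> y' \<and> y' - x' = y - x \<and> x' < Suc n * \<theta>"
      then have lt: "x' < y'" using that by simp
      consider "\<theta> \<le> x'" | "x' < \<theta>" "\<theta> < y'" | "y' \<le> \<theta>" by linarith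
      then show False
      proof cases
        case 1
        have "\<phi> (x' - \<theta>) = \<phi> (y' - \<theta>)" using high[of x'] high[of y'] 1 a lt by simp
        with Suc[of "x' - \<theta>" "y' - \<theta>"] 1 a \<theta> show False by (simp add: algebra_simps)
      next
        case 2
        have "\<phi> x' \<le> \<phi> \<theta>" using 2 a step_le by (intro mono_onD[OF mo]) auto
        then have "\<beta> * \<phi> x' \<le> \<beta> * \<phi> \<theta>" using \<beta> by simp
        then have "\<phi> (y' - \<theta>) \<le> 0" using high[of y'] a 2 at_step by simp
        with pos[of "y' - \<theta>"] 2 a \<theta> show False by simp
      next
        case 3
        then have "(\<rho> x', \<rho> y') \<in> ?K"
          using a lt low[of x'] low[of y'] rho_range[of x'] rho_range[of y'] by auto
        with max[of "\<rho> x'" "\<rho> y'"] expand[of x' y'] 3 a lt show False by simp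
      qed
    qed
  qed (auto simp: not_less)
  have "\<not> x < y"
  proof
    assume "x < y"
    obtain n :: nat where "x / \<theta> < n" using reals_Archimedean2 by blast
    then have "x < n * \<theta>" using \<theta> by (simp add: field_simps)
    with no_plateau[OF \<open>x < y\<close>, of x y n] xy show False by simp
  qed
  have "strict_mono_on {0..L} \<phi>"
  proof (rule strict_mono_onI)
    fix u v assume uv: "u \<in> {0..L}" "v \<in> {0..L}" "u < v"
    then have "\<phi> u \<le> \<phi> v" by (intro mono_onD[OF mo]) auto
    moreover have "\<phi> u \<noteq> \<phi> v"
      using max[of u v] uv \<open>\<not> x < y\<close> by auto
    ultimately show "\<phi> u < \<phi> v" by simp
  qed
  then show ?thesis using that[OF co _ _ _ low high] admissible_0[OF ad] admissible_L[OF ad] by blast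
qed

end

section \<open>The conjugate slope at the chosen parameters\<close>

text \<open>In the angle coordinate, \<open>T (cos \<theta>)\<close> is the Markov map treated above. The two conjugation equations
agree with the target modulo integers, so the fractional part in \<open>S \<beta>\<close> needs only that the
conjugacy takes values in \<open>[0, 1)\<close>.\<close>
lemma conjugate_cos:
  assumes k: "2 \<le> k" and \<theta>_def: "\<theta> = pi / (2 * real k)"
    and \<beta>: "1 < \<beta>" "geometric_sum \<beta> k = 1"
  shows "conjugate (cos \<theta>) \<beta>"
proof -
  have angle: "0 < \<theta>" "\<theta> < pi / 2" and L: "k * \<theta> = pi / 2"
    using k by (auto simp: \<theta>_def field_simps)
  have s: "0 < sin \<theta>" and c: "0 < cos \<theta>" "cos \<theta> < 1"
    using angle cos_monotone_0_pi[of 0 \<theta>] by (auto intro: sin_gt_zero cos_gt_zero_pi)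
  interpret expanding_markov_map \<theta> \<beta> k "angle_branch \<theta>"
    using angle k \<beta> L continuous_angle_branch[OF angle] angle_branch_end[OF angle] angle_branch_expands[OF angle]
    by unfold_locales auto
  obtain \<Phi> where \<Phi>: "continuous_on {0..L} \<Phi>" "strict_mono_on {0..L} \<Phi>" "\<Phi> 0 = 0" "\<Phi> L = 1"
    and low: "\<And>u. u \<in> {0..\<theta>} \<Longrightarrow> \<Phi> (angle_branch \<theta> u) = \<beta> * \<Phi> u"
    and high: "\<And>u. u \<in> {\<theta>..L} \<Longrightarrow> \<Phi> (u - \<theta>) = \<beta> * \<Phi> u - 1"
    by (rule conjugating_function) blast
  define \<phi> where "\<phi> x = \<Phi> (arctan (sin \<theta> * x))" for x
  have dom: "arctan (sin \<theta> * x) \<in> {0..<pi/2}" if "0 \<le> x" for x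
    using that s arctan_ubound by simp
  have rng: "\<phi> x \<in> {0..<1}" if "0 \<le> x" for x
  proof -
    have "\<Phi> (arctan (sin \<theta> * x)) < \<Phi> L"
      using dom[OF that] by (intro strict_mono_onD[OF \<Phi>(2)]) (auto simp: L)
    moreover have "\<Phi> 0 \<le> \<Phi> (arctan (sin \<theta> * x))"
      using dom[OF that] by (intro strict_mono_on_leD[OF \<Phi>(2)]) (auto simp: L)
    ultimately show ?thesis using \<Phi> by (simp add: \<phi>_def)
  qed
  have "continuous_on {0..} \<phi>"
    unfolding \<phi>_def
  proof (rule continuous_on_compose2[OF \<Phi>(1)])
    show "continuous_on {0..} (\<lambda>x. arctan (sin \<theta> * x))" by (intro continuous_intros)
    show "(\<lambda>x. arctan (sin \<theta> * x)) ` {0..} \<subseteq> {0..L}" unfolding L using dom by fastforce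
  qed
  moreover have "inj_on \<phi> {0..}"
  proof (rule inj_onI)
    fix x y assume xy: "x \<in> {0..}" "y \<in> {0..}" "\<phi> x = \<phi> y"
    then have "arctan (sin \<theta> * x) = arctan (sin \<theta> * y)"
      using dom[of x] dom[of y] inj_onD[OF strict_mono_on_imp_inj_on[OF \<Phi>(2)]]
      by (simp add: \<phi>_def L)
    then show "x = y" using s by (simp add: arctan_eq_iff)
  qed
  moreover have "path_connected {0::real..}" by (intro convex_imp_path_connected) simp
  ultimately obtain \<psi> where "homeomorphism {0..} (\<phi> ` {0..}) \<phi> \<psi>"
    using injective_into_1d_eq_homeomorphism by blast
  moreover have "\<phi> ` {0..} = {0..<1}"
  proof (intro equalityI subsetI)
    fix t :: real assume t: "t \<in> {0..<1}"
    then obtain u where u: "0 \<le> u" "u \<le> L" "\<Phi> u = t"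
      using IVT'[of \<Phi> 0 t L] \<Phi> angle by auto
    then have "u < pi / 2" using t \<Phi>(4) by (cases "u = L") (auto simp: L)
    then have "\<phi> (tan u / sin \<theta>) = t" "0 \<le> tan u / sin \<theta>"
      using u s pi_gt_zero arctan_tan[of u] by (auto simp: \<phi>_def intro!: divide_nonneg_pos tan_pos_pi2_le)
    then show "t \<in> \<phi> ` {0..}" by (intro image_eqI[of _ _ "tan u / sin \<theta>"]) auto
  qed (use rng in auto)
  moreover have "\<phi> (T (cos \<theta>) x) = S \<beta> (\<phi> x)" if x: "0 \<le> x" for x
  proof -
    have "\<exists>m::int. \<phi> (T (cos \<theta>) x) = \<beta> * \<phi> x - m"
    proof (cases "x < 1 / cos \<theta>")
      case True
      then have "sin \<theta> * x \<le> tan \<theta>" using s c by (simp add: tan_def field_simps)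
      then have "arctan (sin \<theta> * x) \<le> arctan (tan \<theta>)" by (rule arctan_monotone')
      then have "arctan (sin \<theta> * x) \<le> \<theta>" using angle by (simp add: arctan_tan)
      then have "\<phi> (T (cos \<theta>) x) = \<beta> * \<phi> x - of_int 0"
        using arctan_T_low[OF angle x True] low[of "arctan (sin \<theta> * x)"] dom[OF x] by (simp add: \<phi>_def)
      then show ?thesis by blast
    next
      case False
      then have "tan \<theta> \<le> sin \<theta> * x" using s c by (simp add: tan_def field_simps)
      then have "arctan (tan \<theta>) \<le> arctan (sin \<theta> * x)" by (rule arctan_monotone')
      then have "\<theta> \<le> arctan (sin \<theta> * x)" using angle by (simp add: arctan_tan)
      then have "\<phi> (T (cos \<theta>) x) = \<beta> * \<phi> x - of_int 1"
        using arctan_T_high[OF angle, of x] False high[of "arctan (sin \<theta> * x)"] dom[OF x] by (simp add: \<phi>_def L)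
      then show ?thesis by blast
    qed
    then obtain m :: int where "\<phi> (T (cos \<theta>) x) = \<beta> * \<phi> x - m" ..
    moreover have "\<phi> (T (cos \<theta>) x) \<in> {0..<1}" using rng T_nonneg[OF c x] by blast
    ultimately show ?thesis by (simp add: S_def eq_commute[of _ "frac _"] frac_unique_iff)
  qed
  ultimately show ?thesis unfolding conjugate_def by metis
qed

text \<open>The only alternative to increasing would be decreasing, and then \<open>\<phi> 0\<close> would be a largest element
of \<open>[0, 1)\<close>.\<close>
lemma homeomorphism_half_line_increasing:
  fixes \<phi> :: "real \<Rightarrow> real"
  assumes hom: "homeomorphism {0..} {0..<1} \<phi> \<psi>"
  shows "\<phi> 0 = 0" "strict_mono_on {0..} \<phi>"
proof -
  have co: "continuous_on {0..} \<phi>" and im: "\<phi> ` {0..} = {0..<1}"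
    using hom by (auto simp: homeomorphism_def)
  have inj: "inj_on \<phi> {0..}" using homeomorphism_apply1[OF hom] by (rule inj_on_inverseI)
  have between: "\<phi> 0 < \<phi> x \<and> \<phi> x < \<phi> y \<or> \<phi> y < \<phi> x \<and> \<phi> x < \<phi> 0" if "0 < x" "x < y" for x y
    using that by (intro continuous_inj_imp_mono continuous_on_subset[OF co] inj_on_subset[OF inj]) auto
  have nn: "0 \<le> \<phi> x" "\<phi> x < 1" if "0 \<le> x" for x using im that by auto
  show \<phi>0: "\<phi> 0 = 0"
  proof (rule ccontr)
    assume ne: "\<phi> 0 \<noteq> 0"
    obtain z where z: "0 \<le> z" "\<phi> z = 0" using im by (metis atLeastLessThan_iff atLeast_iff imageE order_refl zero_less_one)
    have "(1 + \<phi> 0) / 2 \<in> \<phi> ` {0..}" unfolding im using nn[of 0] by simp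
    then obtain w where w: "0 \<le> w" "\<phi> w = (1 + \<phi> 0) / 2" by auto
    have "z \<noteq> 0" "w \<noteq> 0" "w \<noteq> z" using ne z w nn[of 0] by auto
    then show False
      using between[of z w] between[of w z] z w nn[of 0] by (cases "z < w") auto
  qed
  show "strict_mono_on {0..} \<phi>"
  proof (rule strict_mono_onI)
    fix x y :: real assume xy: "x \<in> {0..}" "y \<in> {0..}" "x < y"
    show "\<phi> x < \<phi> y"
    proof (cases "x = 0")
      case True
      have "\<phi> y \<noteq> \<phi> 0" using inj xy by (auto dest: inj_onD)
      then show ?thesis using True \<phi>0 nn[of y] xy by simp
    next
      case False
      then show ?thesis using between[of x y] xy \<phi>0 nn[of y] by auto
    qed
  qed
qed

text \<open>A conjugacy \<open>\<phi>\<close> matches the zeros of the two maps. As \<open>T (cos \<theta>)\<close> has exactly two,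
\<open>\<beta> \<le> 2\<close> and the cut point \<open>1 / cos \<theta>\<close> goes to \<open>1/\<beta>\<close>. Beyond the cut point the conjugation
equation is therefore \<open>\<phi> (T (cos \<theta>) x) = \<beta> * \<phi> x - 1\<close>, and following it backwards from \<open>0\<close> along the
points \<open>a j\<close> of angle \<open>j * \<theta>\<close> gives \<open>\<phi> (a j) = geometric_sum \<beta> j\<close>. Finally the last branch has the
image \<open>[0, a (k - 1))\<close> and corresponds to \<open>t \<mapsto> \<beta> * t - 1\<close> with image \<open>[0, \<beta> - 1)\<close>; comparing the ends
gives \<open>geometric_sum \<beta> (k - 1) = \<beta> - 1\<close>, which is the claim.\<close>
lemma conjugate_cos_unique:
  assumes k: "2 \<le> k" and \<theta>_def: "\<theta> = pi / (2 * real k)"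
    and \<beta>: "1 < \<beta>" and conj: "conjugate (cos \<theta>) \<beta>"
  shows "geometric_sum \<beta> k = 1"
proof -
  have \<theta>: "0 < \<theta>" "\<theta> < pi / 2" and L: "k * \<theta> = pi / 2"
    using k by (auto simp: \<theta>_def field_simps)
  have s: "0 < sin \<theta>" and c: "0 < cos \<theta>" "cos \<theta> < 1"
    using \<theta> cos_monotone_0_pi[of 0 \<theta>] by (auto intro: sin_gt_zero cos_gt_zero_pi)
  have tan_eq: "tan \<theta> / sin \<theta> = 1 / cos \<theta>" using s by (simp add: tan_def)
  obtain \<phi> \<psi> where hom: "homeomorphism {0..} {0..<1} \<phi> \<psi>"
    and eq: "\<And>x. 0 \<le> x \<Longrightarrow> \<phi> (T (cos \<theta>) x) = S \<beta> (\<phi> x)"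
    using conj by (auto simp: conjugate_def)
  note \<phi>0 = homeomorphism_half_line_increasing(1)[OF hom]
    and mono = homeomorphism_half_line_increasing(2)[OF hom]
  have im: "\<phi> ` {0..} = {0..<1}" using hom by (simp add: homeomorphism_def)
  have less: "\<phi> x < \<phi> y \<longleftrightarrow> x < y" if "0 \<le> x" "0 \<le> y" for x y
    using strict_mono_on_less[OF mono] that by auto
  have rng: "0 \<le> \<phi> x" "\<phi> x < 1" if "0 \<le> x" for x using im that by auto
  have pre: "\<exists>x\<ge>0. \<phi> x = t" if "0 \<le> t" "t < 1" for t
  proof -
    have "t \<in> \<phi> ` {0..}" unfolding im using that by simp
    then show ?thesis by auto
  qed
  have zero: "x = 0 \<or> x = 1 / cos \<theta>" if "0 \<le> x" "S \<beta> (\<phi> x) = 0" for x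
  proof -
    have "\<phi> (T (cos \<theta>) x) = \<phi> 0" using eq that \<phi>0 by simp
    moreover have T0: "0 \<le> T (cos \<theta>) x" using T_nonneg[OF c that(1)] .
    ultimately have "T (cos \<theta>) x = 0"
      using less[OF _ T0, of 0] T0 by fastforce
    then show ?thesis using T_eq_0_iff[OF c that(1)] by simp
  qed
  have "\<exists>x\<ge>0. \<phi> x = 1 / \<beta>" using \<beta> by (intro pre) auto
  then have cut: "\<phi> (1 / cos \<theta>) = 1 / \<beta>"
    using zero \<phi>0 \<beta> by (force simp: S_def)
  \<comment> \<open>Otherwise \<open>2/\<beta>\<close> would be a third zero of \<open>S \<beta>\<close>.\<close>
  have \<beta>2: "\<beta> \<le> 2"
  proof (rule ccontr)
    assume "\<not> \<beta> \<le> 2"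
    then have "\<exists>x\<ge>0. \<phi> x = 2 / \<beta>" by (intro pre) auto
    then have "\<phi> (1 / cos \<theta>) = 2 / \<beta>"
      using zero \<phi>0 \<beta> by (force simp: S_def)
    then show False using cut \<beta> by simp
  qed
  have high: "\<phi> (T (cos \<theta>) x) = \<beta> * \<phi> x - 1" if x: "1 / cos \<theta> \<le> x" for x
  proof -
    have x0: "0 \<le> x" using x c by (meson divide_nonneg_pos order_trans zero_le_one)
    have "1 / \<beta> \<le> \<phi> x" using less[of x "1 / cos \<theta>"] x x0 c cut by (simp add: not_less[symmetric])
    then have "1 \<le> \<beta> * \<phi> x" using \<beta> by (simp add: field_simps)
    moreover have "\<beta> * \<phi> x < 2"
    proof -
      have "\<beta> * \<phi> x < \<beta> * 1" using rng[OF x0] \<beta> by (intro mult_strict_left_mono) auto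
      then show ?thesis using \<beta>2 by simp
    qed
    ultimately have "frac (\<beta> * \<phi> x) = \<beta> * \<phi> x - 1"
      by (simp add: frac_unique_iff)
    then show ?thesis using eq[OF x0] by (simp add: S_def)
  qed
  define a where "a j = tan (real j * \<theta>) / sin \<theta>" for j
  have bound: "real j * \<theta> < pi / 2" if "j < k" for j
    using that \<theta> L by (metis mult_strict_right_mono of_nat_less_iff)
  have a_nn: "0 \<le> a j" if "j < k" for j
    using bound[OF that] \<theta> s by (auto simp: a_def intro!: divide_nonneg_pos tan_pos_pi2_le)
  have orbit: "\<phi> (a j) = geometric_sum \<beta> j" if "j < k" for j
    using that
  proof (induction j)
    case 0
    then show ?case by (simp add: a_def \<phi>0)
  next
    case (Suc j)
    have b: "Suc j * \<theta> < pi / 2" using bound[OF Suc.prems] .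
    have "tan \<theta> \<le> tan (Suc j * \<theta>)" using b \<theta> by (intro tan_mono_le) auto
    then have ge: "1 / cos \<theta> \<le> a (Suc j)"
      using s by (simp add: a_def flip: tan_eq) (simp add: divide_right_mono)
    have "arctan (sin \<theta> * T (cos \<theta>) (a (Suc j))) = arctan (tan (Suc j * \<theta>)) - \<theta>"
      using arctan_T_high[OF \<theta> ge] s by (simp add: a_def)
    also have "arctan (tan (Suc j * \<theta>)) = Suc j * \<theta>"
      using b \<theta> by (intro arctan_tan) (auto intro: less_le_trans[of _ 0])
    finally have "arctan (sin \<theta> * T (cos \<theta>) (a (Suc j))) = j * \<theta>" by (simp add: algebra_simps)
    then have "sin \<theta> * T (cos \<theta>) (a (Suc j)) = tan (j * \<theta>)" by (metis tan_arctan)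
    then have "T (cos \<theta>) (a (Suc j)) = a j" using s by (simp add: a_def field_simps)
    then have "geometric_sum \<beta> j = \<beta> * \<phi> (a (Suc j)) - 1"
      using high[OF ge] Suc by simp
    then show ?case using \<beta> by (simp add: geometric_sum_Suc)
  qed
  obtain m where m: "k = Suc m" using k by (cases k) auto
  have last: "real m * \<theta> = pi / 2 - \<theta>" using L by (simp add: m algebra_simps)
  have mk: "m < k" by (simp add: m)
  have am: "arctan (sin \<theta> * a m) = pi / 2 - \<theta>"
    using s \<theta> by (simp add: a_def last arctan_tan)
  \<comment> \<open>Both suprema of images coincide: a value strictly between them would be attained by one of the
last branches and missed by the other.\<close>
  have "\<phi> (a m) = \<beta> - 1"
  proof (rule linorder_cases[of "\<phi> (a m)" "\<beta> - 1"])
    assume lt: "\<phi> (a m) < \<beta> - 1"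
    then obtain t where t: "\<phi> (a m) < t" "t < \<beta> - 1" using dense by blast
    have "0 \<le> t" using rng[OF a_nn[OF mk]] t by simp
    then have "\<exists>x\<ge>0. \<phi> x = (t + 1) / \<beta>" using t \<beta> by (intro pre) auto
    then obtain x where x: "0 \<le> x" "\<phi> x = (t + 1) / \<beta>" by blast
    have "1 / \<beta> \<le> \<phi> x" using x \<open>0 \<le> t\<close> \<beta> by (simp add: divide_right_mono)
    then have ge: "1 / cos \<theta> \<le> x" using less[of x "1 / cos \<theta>"] x c cut by (simp add: not_less[symmetric])
    have "\<phi> (T (cos \<theta>) x) = t" using high[OF ge] x \<beta> by simp
    moreover have "T (cos \<theta>) x < a m"
    proof -
      have "arctan (sin \<theta> * T (cos \<theta>) x) < arctan (sin \<theta> * a m)"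
        unfolding am arctan_T_high[OF \<theta> ge] using arctan_ubound by simp
      then show ?thesis using s by (simp add: arctan_less_iff)
    qed
    ultimately have "t < \<phi> (a m)" using less T_nonneg[OF c x(1)] a_nn[OF mk] by force
    then show ?thesis using t by simp
  next
    assume gt: "\<beta> - 1 < \<phi> (a m)"
    then have "\<exists>y\<ge>0. \<phi> y = \<beta> - 1" using rng[OF a_nn[OF mk]] \<beta> by (intro pre) auto
    then obtain y where y: "0 \<le> y" "\<phi> y = \<beta> - 1" by blast
    then have "y < a m" using gt less a_nn[OF mk] by force
    then have "arctan (sin \<theta> * y) < arctan (sin \<theta> * a m)" using s by (simp add: arctan_less_iff)
    then have u: "arctan (sin \<theta> * y) + \<theta> < pi / 2" unfolding am by simp
    have u0: "0 \<le> arctan (sin \<theta> * y)" using s y by simp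
    define x where "x = tan (arctan (sin \<theta> * y) + \<theta>) / sin \<theta>"
    have "tan \<theta> \<le> tan (arctan (sin \<theta> * y) + \<theta>)" using u u0 \<theta> by (intro tan_mono_le) auto
    then have ge: "1 / cos \<theta> \<le> x"
      using s by (simp add: x_def flip: tan_eq) (simp add: divide_right_mono)
    have "- (pi / 2) < arctan (sin \<theta> * y) + \<theta>" using u0 \<theta> by linarith
    then have "arctan (sin \<theta> * x) = arctan (sin \<theta> * y) + \<theta>"
      using s arctan_tan[OF _ u] by (simp add: x_def)
    then have "T (cos \<theta>) x = y" using arctan_T_high[OF \<theta> ge] s by (simp add: arctan_eq_iff)
    then have "\<phi> x = 1" using high[OF ge] y \<beta> by simp
    moreover have "0 \<le> x" using ge c by (meson divide_nonneg_pos order_trans zero_le_one)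
    ultimately show ?thesis using rng[of x] by simp
  qed
  then show ?thesis using orbit[OF mk] \<beta> by (simp add: m geometric_sum_Suc)
qed

lemma beta_cos:
  assumes "2 \<le> k"
  shows "1 < beta (cos (pi / (2 * real k)))" "geometric_sum (beta (cos (pi / (2 * real k)))) k = 1"
proof -
  obtain b where b: "1 < b" "geometric_sum b k = 1"
    using geometric_sum_root_exists[OF assms] .
  have "beta (cos (pi / (2 * real k))) = b"
    unfolding beta_def
  proof (rule the_equality)
    show "1 < b \<and> conjugate (cos (pi / (2 * real k))) b"
      using conjugate_cos[OF assms refl b] b by simp
  next
    fix c assume c: "1 < c \<and> conjugate (cos (pi / (2 * real k))) c"
    then have "geometric_sum c k = 1" using conjugate_cos_unique[OF assms refl] by blast
    then show "c = b"
      using geometric_sum_strict_antimono[of b c k] geometric_sum_strict_antimono[of c b k] b c assms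
      by (cases b c rule: linorder_cases) auto
  qed
  with b show "1 < beta (cos (pi / (2 * real k)))" "geometric_sum (beta (cos (pi / (2 * real k)))) k = 1"
    by auto
qed
section \<open>Flatness at one\<close>

text \<open>A nonzero power series with subdegree \<open>n\<close> has a nonzero limit at \<open>0\<close> after division by the \<open>n\<close>-th
power. A single sequence of arguments suffices to see this limit.\<close>
lemma has_fps_expansion_vanish_if_flat:
  fixes g :: "real \<Rightarrow> real" and t :: "nat \<Rightarrow> real"
  assumes g: "g has_fps_expansion G" and t: "t \<longlonglongrightarrow> 0" "eventually (\<lambda>k. t k \<noteq> 0) sequentially"
    and flat: "\<And>n. (\<lambda>k. g (t k) / t k ^ n) \<longlonglongrightarrow> 0"
  shows "G = 0"
proof (rule ccontr)
  assume "G \<noteq> 0"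
  define n where "n = subdegree G"
  define q where "q x = (if x = 0 then fps_nth G n else g x / x ^ n)" for x
  have "q has_fps_expansion fps_shift n G"
    unfolding q_def by (rule has_fps_expansion_shift[OF g]) (simp_all add: n_def)
  then have "isCont q 0" by (rule has_fps_expansion_imp_continuous)
  then have "(\<lambda>k. q (t k)) \<longlonglongrightarrow> q 0" using t(1) by (rule isCont_tendsto_compose)
  moreover have "(\<lambda>k. q (t k)) \<longlonglongrightarrow> 0"
    by (rule Lim_transform_eventually[OF flat[of n]])
       (use t(2) in eventually_elim, simp add: q_def)
  ultimately have "fps_nth G n = 0" using LIMSEQ_unique by (fastforce simp: q_def)
  then show False using \<open>G \<noteq> 0\<close> by (simp add: n_def)
qed

lemma beta_cos_gap:
  assumes "2 \<le> k"
  shows "0 < 2 - beta (cos (pi / (2 * real k)))" "2 - beta (cos (pi / (2 * real k))) \<le> (2 / 3) ^ k"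
proof -
  let ?b = "beta (cos (pi / (2 * real k)))"
  have b: "3 / 2 \<le> ?b" "2 - ?b = (1 / ?b) ^ k"
    using geometric_sum_root_bounds[OF beta_cos[OF assms] assms] by auto
  show "0 < 2 - ?b" using b by simp
  have "1 / ?b \<le> 2 / 3" using b(1) by (simp add: field_simps)
  then show "2 - ?b \<le> (2 / 3) ^ k" unfolding b(2) using b(1) by (intro power_mono) auto
qed

theorem corollary4p22: "\<not> real_analytic_on beta {0<..<2}"
proof
  assume "real_analytic_on beta {0<..<2}"
  then obtain F where F: "(\<lambda>t. beta (1 + t)) has_fps_expansion F"
    unfolding real_analytic_on_def by (metis greaterThanLessThan_iff one_less_numeral_iff semiring_norm(76) zero_less_one)
  define t where "t k = cos (pi / (2 * real k)) - 1" for k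
  have G: "(\<lambda>x. beta (1 + x) - 2) has_fps_expansion F - fps_const 2"
    using F by (intro has_fps_expansion_diff has_fps_expansion_const)
  have lim: "t \<longlonglongrightarrow> 0" unfolding t_def by real_asymp
  have "eventually (\<lambda>k. t k < 0) sequentially" unfolding t_def by real_asymp
  then have ne: "eventually (\<lambda>k. t k \<noteq> 0) sequentially" by eventually_elim simp
  \<comment> \<open>A quotient of an exponentially small quantity by a power of \<open>cos (pi / (2 * k)) - 1\<close>, which is of
order \<open>1 / k\<^sup>2\<close>.\<close>
  have flat: "(\<lambda>k. (beta (1 + t k) - 2) / t k ^ n) \<longlonglongrightarrow> 0" for n
  proof (rule Lim_null_comparison)
    show "(\<lambda>k. (2 / 3) ^ k / \<bar>t k\<bar> ^ n) \<longlonglongrightarrow> 0" unfolding t_def by real_asymp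
    show "\<forall>\<^sub>F k in sequentially. norm ((beta (1 + t k) - 2) / t k ^ n) \<le> (2 / 3) ^ k / \<bar>t k\<bar> ^ n"
      using eventually_ge_at_top[of 2]
    proof eventually_elim
      case (elim k)
      then show ?case using beta_cos_gap[OF elim]
        by (simp add: t_def abs_divide power_abs divide_right_mono)
    qed
  qed
  have "F - fps_const 2 = 0"
    by (rule has_fps_expansion_vanish_if_flat[OF G lim ne flat])
  with G have "eventually (\<lambda>x. beta (1 + x) - 2 = 0) (nhds 0)"
    by (simp add: has_fps_expansion_def eq_commute[of 0])
  then have "eventually (\<lambda>k. beta (1 + t k) - 2 = 0) sequentially"
    using lim by (rule eventually_compose_filterlim)
  with eventually_ge_at_top[of 2] have "eventually (\<lambda>k::nat. False) sequentially"
  proof eventually_elim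
    case (elim k)
    then show ?case using beta_cos_gap[of k] by (simp add: t_def)
  qed
  then show False by simp
qed
end
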